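(* Let $\mathcal{R}$ be an associative ring with unit $1\neq 0$, let $a,x\in\mathcal{R}$ and let $l\geq 1$ be an integer. Then the following assertions are equivalent: (1) $a$ is Drazin invertible with index $k\leq l$, and $x=a^{D}$. (2) $\varphi_{xa}=\varphi_{ax}=\rho_{a^{l}\mathcal{R},\,{\rm rann}(a^{l})}$ and $x\mathcal{R}\subseteq a^{l}\mathcal{R}$. (3) $\varphi_{xa}=\varphi_{ax}=\rho_{a^{l}\mathcal{R},\,{\rm rann}(a^{l})}$ and ${\rm rann}(a^{l})\subseteq{\rm rann}(x)$. (4) ${}_{xa}\varphi={}_{ax}\varphi=\rho_{\mathcal{R}a^{l},\,{\rm lann}(a^{l})}$ and $\mathcal{R}x\subseteq\mathcal{R}a^{l}$. (5) ${}_{xa}\varphi={}_{ax}\varphi=\rho_{\mathcal{R}a^{l},\,{\rm lann}(a^{l})}$ and ${\rm lann}(a^{l})\subseteq{\rm lann}(x)$.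
   Context: An element $a\in\mathcal{R}$ is Drazin invertible if there exist $k\in\{1,2,\ldots\}$ and $x\in\mathcal{R}$ with $xax=x$, $ax=xa$ and $xa^{k+1}=a^{k}$; the smallest such $k$ is the index of $a$, and the (unique) such $x$ is the Drazin inverse $a^{D}$. Notation: $a\mathcal{R}=\{ar:r\in\mathcal{R}\}$, $\mathcal{R}a=\{ra:r\in\mathcal{R}\}$, ${\rm rann}(a)=\{r\in\mathcal{R}:ar=0\}$, ${\rm lann}(a)=\{r\in\mathcal{R}:ra=0\}$. The additive group endomorphisms $\varphi_a,{}_a\varphi:\mathcal{R}\to\mathcal{R}$ are $\varphi_a(r)=ar$ and ${}_a\varphi(r)=ra$. For additive subgroups $\mathcal{S},\mathcal{T}$ of $\mathcal{R}$, $\mathcal{R}=\mathcal{S}\oplus\mathcal{T}$ means $\mathcal{R}=\mathcal{S}+\mathcal{T}$ and $\mathcal{S}\cap\mathcal{T}=\{0\}$; in that case $\rho_{\mathcal{S},\mathcal{T}}:\mathcal{R}\to\mathcal{R}$ is the group endomorphism $\rho_{\mathcal{S},\mathcal{T}}(s+t)=s$ for $s\in\mathcal{S}$, $t\in\mathcal{T}$. Convention: whenever $\rho_{\mathcal{S},\mathcal{T}}$ is written, it is implicitly asserted that $\mathcal{R}=\mathcal{S}\oplus\mathcal{T}$. *)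

theory Defs
  imports Main
begin

text \<open>
  The ring is the whole type \<open>'a :: ring_1\<close>, which is associative and unital with
  \<open>0 \<noteq> 1\<close> and need not be commutative.
\<close>

definition drazin_equations :: "'a::ring_1 \<Rightarrow> nat \<Rightarrow> 'a \<Rightarrow> bool" where
  "drazin_equations a k x \<longleftrightarrow>
     k \<ge> 1 \<and> x * a * x = x \<and> a * x = x * a \<and> x * a ^ (k + 1) = a ^ k"

definition drazin_invertible :: "'a::ring_1 \<Rightarrow> bool" where
  "drazin_invertible a \<longleftrightarrow> (\<exists>k x. drazin_equations a k x)"

text \<open>The next two are meaningful only for Drazin invertible \<open>a\<close>.\<close>

definition drazin_index :: "'a::ring_1 \<Rightarrow> nat" where
  "drazin_index a = (LEAST k. \<exists>x. drazin_equations a k x)"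

definition drazin_inverse :: "'a::ring_1 \<Rightarrow> 'a" where
  "drazin_inverse a = (THE x. \<exists>k. drazin_equations a k x)"

definition right_ideal_of :: "'a::ring_1 \<Rightarrow> 'a set" where
  "right_ideal_of a = {a * r | r. True}"

definition left_ideal_of :: "'a::ring_1 \<Rightarrow> 'a set" where
  "left_ideal_of a = {r * a | r. True}"

definition rann :: "'a::ring_1 \<Rightarrow> 'a set" where
  "rann a = {r. a * r = 0}"

definition lann :: "'a::ring_1 \<Rightarrow> 'a set" where
  "lann a = {r. r * a = 0}"

definition left_mult :: "'a::ring_1 \<Rightarrow> 'a \<Rightarrow> 'a" where
  "left_mult a = (\<lambda>r. a * r)"

definition right_mult :: "'a::ring_1 \<Rightarrow> 'a \<Rightarrow> 'a" where
  "right_mult a = (\<lambda>r. r * a)"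

definition additive_subgroup :: "'a::ab_group_add set \<Rightarrow> bool" where
  "additive_subgroup S \<longleftrightarrow> 0 \<in> S \<and> (\<forall>s\<in>S. \<forall>t\<in>S. s + t \<in> S) \<and> (\<forall>s\<in>S. - s \<in> S)"

definition is_direct_sum :: "'a::ab_group_add set \<Rightarrow> 'a set \<Rightarrow> bool" where
  "is_direct_sum S T \<longleftrightarrow>
     additive_subgroup S \<and> additive_subgroup T \<and>
     UNIV = {s + t | s t. s \<in> S \<and> t \<in> T} \<and> S \<inter> T = {0}"

text \<open>
  \<open>proj_onto S T\<close> is the projection onto \<open>S\<close> along \<open>T\<close>. It is meaningful only if
  \<open>is_direct_sum S T\<close> holds, so \<open>is_proj_onto\<close>, which expresses that a map equals
  this projection, also asserts the decomposition.
\<close>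

definition proj_onto :: "'a::ab_group_add set \<Rightarrow> 'a set \<Rightarrow> 'a \<Rightarrow> 'a" where
  "proj_onto S T r = (THE s. s \<in> S \<and> (\<exists>t\<in>T. r = s + t))"

definition is_proj_onto :: "('a::ab_group_add \<Rightarrow> 'a) \<Rightarrow> 'a set \<Rightarrow> 'a set \<Rightarrow> bool" where
  "is_proj_onto f S T \<longleftrightarrow> is_direct_sum S T \<and> f = proj_onto S T"

end

theory Submission
  imports Defs "HOL.Modules"
begin

text \<open>
  Everything revolves around the element \<open>e = a * x\<close>. If \<open>x\<close> satisfies the Drazin equations for
  the exponent \<open>l\<close>, then \<open>a\<close> and \<open>x\<close> commute and \<open>e\<close> is an idempotent with
  \<open>e = a ^ l * x ^ l = x ^ l * a ^ l\<close> and \<open>e * a ^ l = a ^ l = a ^ l * e\<close>. So multiplication by \<open>e\<close>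
  on either side has the same image and the same kernel as multiplication by \<open>a ^ l\<close>, and
  an idempotent map is the projection onto its image along its kernel. The inclusions in the four
  statements hold because \<open>x = e * x = x * e\<close> exhibits \<open>x\<close> as a right and a left multiple
  of \<open>a ^ l\<close>.

  Conversely, suppose that \<open>a\<close> and \<open>x\<close> commute and that multiplication by \<open>e\<close> is the projection onto
  the image of multiplication by \<open>a ^ l\<close> along its kernel. The projection fixes
  \<open>a ^ l\<close>, which lies in its image, and this is the equation \<open>x * a ^ (l + 1) = a ^ l\<close>; it can also be
  read off from \<open>1 - e\<close> being in the kernel. The remaining equation \<open>x * a * x = x\<close> follows from the additional
  inclusion in the same way: either \<open>x\<close> is in the image and therefore fixed, or \<open>1 - e\<close> is
  annihilated by \<open>x\<close>.

  Hence each of the four projection statements is equivalent to the Drazin equations for \<open>l\<close>. For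
  the statement about the index and the Drazin inverse it remains to see that solutions
  are unique and persist when the exponent grows. Uniqueness comes from the projection
  itself: it is determined by \<open>a\<close> and \<open>l\<close>, hence so is \<open>e\<close>, and \<open>e\<close> determines \<open>x\<close>.
\<close>

section \<open>Projections as additive maps\<close>

text \<open>
  The definite description in \<open>proj_onto\<close> is well defined because two decompositions of the same
  element differ by an element of \<open>S \<inter> T\<close>.
\<close>

lemma proj_onto_eqI:
  assumes "is_direct_sum S T" "s \<in> S" "t \<in> T"
  shows "proj_onto S T (s + t) = s"
  unfolding proj_onto_def
proof (rule the_equality)
  show "s \<in> S \<and> (\<exists>t'\<in>T. s + t = s + t')" using assms by blast
next
  fix s' assume "s' \<in> S \<and> (\<exists>t'\<in>T. s + t = s' + t')"
  then obtain t' where s': "s' \<in> S" and t': "t' \<in> T" and eq: "s + t = s' + t'" by blast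
  have sub: "additive_subgroup S" "additive_subgroup T" and int: "S \<inter> T = {0}"
    using assms(1) by (auto simp: is_direct_sum_def)
  have "s' + - s \<in> S"
    using sub(1) s' assms(2) unfolding additive_subgroup_def by blast
  moreover have "t + - t' \<in> T"
    using sub(2) t' assms(3) unfolding additive_subgroup_def by blast
  moreover have "s' + - s = t + - t'" using eq by (simp add: algebra_simps)
  ultimately have "s' + - s \<in> S \<inter> T" by simp
  then show "s' = s" using int by simp
qed

lemma is_proj_onto_iff:
  "is_proj_onto f S T \<longleftrightarrow> is_direct_sum S T \<and> (\<forall>r. f r \<in> S \<and> r - f r \<in> T)"
proof (cases "is_direct_sum S T")
  case ds: True
  have "f = proj_onto S T \<longleftrightarrow> (\<forall>r. f r \<in> S \<and> r - f r \<in> T)"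
  proof
    assume f: "f = proj_onto S T"
    show "\<forall>r. f r \<in> S \<and> r - f r \<in> T"
    proof
      fix r
      have "r \<in> {s + t | s t. s \<in> S \<and> t \<in> T}"
        using ds unfolding is_direct_sum_def by blast
      then obtain s t where "r = s + t" "s \<in> S" "t \<in> T" by blast
      with ds f show "f r \<in> S \<and> r - f r \<in> T" by (simp add: proj_onto_eqI)
    qed
  next
    assume f: "\<forall>r. f r \<in> S \<and> r - f r \<in> T"
    show "f = proj_onto S T"
    proof
      fix r
      show "f r = proj_onto S T r"
        using proj_onto_eqI[OF ds, of "f r" "r - f r"] f by simp
    qed
  qed
  with ds show ?thesis by (simp add: is_proj_onto_def)
qed (simp add: is_proj_onto_def)

lemma is_proj_onto_unique:
  "is_proj_onto f S T \<Longrightarrow> is_proj_onto g S T \<Longrightarrow> f = g"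
  by (simp add: is_proj_onto_def)

lemma is_proj_onto_fixes:
  assumes "is_proj_onto f S T" "s \<in> S"
  shows "f s = s"
proof -
  have "is_direct_sum S T" "f = proj_onto S T" using assms(1) by (auto simp: is_proj_onto_def)
  moreover from this have "0 \<in> T" by (simp add: is_direct_sum_def additive_subgroup_def)
  ultimately show ?thesis using proj_onto_eqI[of S T s 0] assms(2) by simp
qed

text \<open>
  Working with the image and kernel of an arbitrary additive map \<open>p\<close>, rather than
  with one-sided ideals and annihilators, lets left and right multiplication by \<open>a ^ l\<close> be treated
  by one argument, although the ring need not be commutative.
\<close>

lemma is_proj_onto_range_kernelI:
  assumes "additive p"
    and range: "\<And>r. e r \<in> range p"
    and fixes_range: "\<And>r. e (p r) = p r"
    and p_e: "\<And>r. p (e r) = p r"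
    and kernel: "\<And>r. p r = 0 \<Longrightarrow> e r = 0"
  shows "is_proj_onto e (range p) {r. p r = 0}"
proof -
  interpret additive p by fact
  have "additive_subgroup (range p)"
    unfolding additive_subgroup_def
  proof (intro conjI ballI)
    show "0 \<in> range p" using zero by (metis rangeI)
    show "s + t \<in> range p" if "s \<in> range p" "t \<in> range p" for s t
      using that by (auto simp flip: add)
    show "- s \<in> range p" if "s \<in> range p" for s
      using that by (auto simp flip: minus)
  qed
  moreover have "additive_subgroup {r. p r = 0}"
    by (auto simp: additive_subgroup_def zero add minus)
  moreover have rest: "r - e r \<in> {r. p r = 0}" for r by (simp add: diff p_e)
  moreover have "UNIV = {s + t | s t. s \<in> range p \<and> t \<in> {r. p r = 0}}"
  proof -
    have "\<exists>s t. r = s + t \<and> s \<in> range p \<and> t \<in> {r. p r = 0}" for r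
      using range rest by (intro exI[of _ "e r"] exI[of _ "r - e r"]) simp
    then show ?thesis by auto
  qed
  moreover have "range p \<inter> {r. p r = 0} = {0}"
  proof -
    have "s = 0" if "s \<in> range p" "p s = 0" for s
      using that fixes_range kernel by (metis (no_types, lifting) imageE)
    moreover have "0 \<in> range p" using zero by (metis rangeI)
    ultimately show ?thesis using zero by blast
  qed
  ultimately show ?thesis
    using range by (auto simp: is_proj_onto_iff is_direct_sum_def)
qed

section \<open>Multiplication maps\<close>

lemma additive_left_mult: "additive (left_mult a)"
  by (simp add: additive_def left_mult_def distrib_left)

lemma additive_right_mult: "additive (right_mult a)"
  by (simp add: additive_def right_mult_def distrib_right)

lemma right_ideal_of_eq_range: "right_ideal_of a = range (left_mult a)"
  by (auto simp: right_ideal_of_def left_mult_def)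

lemma left_ideal_of_eq_range: "left_ideal_of a = range (right_mult a)"
  by (auto simp: left_ideal_of_def right_mult_def)

lemma rann_eq_kernel: "rann a = {r. left_mult a r = 0}"
  by (simp add: rann_def left_mult_def)

lemma lann_eq_kernel: "lann a = {r. right_mult a r = 0}"
  by (simp add: lann_def right_mult_def)

lemma left_mult_eq_iff: "left_mult a = left_mult b \<longleftrightarrow> a = b"
  unfolding left_mult_def by (metis mult.right_neutral)

lemma right_mult_eq_iff: "right_mult a = right_mult b \<longleftrightarrow> a = b"
  unfolding right_mult_def by (metis mult.left_neutral)

lemma self_in_right_ideal_of: "a \<in> right_ideal_of a"
  unfolding right_ideal_of_def by (metis (mono_tags) mem_Collect_eq mult.right_neutral)

lemma self_in_left_ideal_of: "a \<in> left_ideal_of a"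
  unfolding left_ideal_of_def by (metis (mono_tags) mem_Collect_eq mult.left_neutral)

lemma right_ideal_of_subset_iff: "right_ideal_of b \<subseteq> right_ideal_of a \<longleftrightarrow> (\<exists>c. b = a * c)"
proof
  show "\<exists>c. b = a * c" if "right_ideal_of b \<subseteq> right_ideal_of a"
    using that self_in_right_ideal_of[of b] by (auto simp: right_ideal_of_def)
  show "right_ideal_of b \<subseteq> right_ideal_of a" if "\<exists>c. b = a * c"
    proof -
    from that obtain c where "b = a * c" ..
    then have "b * r = a * (c * r)" for r by (simp add: mult.assoc)
    then show ?thesis unfolding right_ideal_of_def by blast
  qed
qed

lemma left_ideal_of_subset_iff: "left_ideal_of b \<subseteq> left_ideal_of a \<longleftrightarrow> (\<exists>c. b = c * a)"
proof
  show "\<exists>c. b = c * a" if "left_ideal_of b \<subseteq> left_ideal_of a"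
    using that self_in_left_ideal_of[of b] by (auto simp: left_ideal_of_def)
  show "left_ideal_of b \<subseteq> left_ideal_of a" if "\<exists>c. b = c * a"
  proof -
    from that obtain c where "b = c * a" ..
    then have "r * b = (r * c) * a" for r by (simp add: mult.assoc)
    then show ?thesis unfolding left_ideal_of_def by blast
  qed
qed

section \<open>Consequences of the Drazin equations\<close>

lemma drazin_equationsD:
  assumes "drazin_equations a l x"
  shows "l \<ge> 1" "a * x = x * a" "x * a * x = x" "a ^ l * (a * x) = a ^ l" "a * x * a ^ l = a ^ l"
proof -
  show l: "l \<ge> 1" and comm: "a * x = x * a" and "x * a * x = x"
    using assms by (auto simp: drazin_equations_def)
  have eq: "x * a * a ^ l = a ^ l"
    using assms by (simp add: drazin_equations_def mult.assoc)
  then show "a * x * a ^ l = a ^ l" by (simp add: comm)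
  have "a ^ l * (x * a) = x * a * a ^ l"
    using comm by (metis mult.assoc power_commuting_commutes)
  with eq show "a ^ l * (a * x) = a ^ l" by (simp add: comm)
qed

lemma drazin_equationsI:
  assumes "l \<ge> 1" "a * x = x * a" "x * a * x = x" "a * x * a ^ l = a ^ l"
  shows "drazin_equations a l x"
  using assms by (simp add: drazin_equations_def mult.assoc)

text \<open>
  This is what turns \<open>a * x\<close> into a multiple of \<open>a ^ l\<close>: inside \<open>a ^ (n + 1) * x ^ (n + 1)\<close> the
  product \<open>a ^ n * x ^ n\<close> collapses to \<open>a * x\<close>, and \<open>a * (a * x) * x = a * x\<close> by idempotence.
\<close>

lemma outer_inverse_power_mult:
  fixes a x :: "'a::ring_1"
  assumes comm: "a * x = x * a" and outer: "x * a * x = x" and "n \<ge> 1"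
  shows "a ^ n * x ^ n = a * x"
  using \<open>n \<ge> 1\<close>
proof (induction n rule: dec_induct)
  case base
  show ?case by simp
next
  case (step n)
  have "a ^ Suc n * x ^ Suc n = a * (a ^ n * x ^ n) * x"
    by (simp only: power_Suc[of a] power_Suc2[of x] mult.assoc)
  also have "\<dots> = a * (x * a * x)" by (simp only: step.IH comm mult.assoc)
  finally show ?case by (simp add: outer)
qed

text \<open>
  A factor \<open>a ^ l\<close> on the left bounds a right ideal or a left annihilator, one on the right bounds
  a left ideal or a right annihilator. Multiplying the factorizations of \<open>a * x = x * a\<close> by \<open>x\<close> gives
  those of \<open>x\<close>.
\<close>

lemma drazin_idempotent_factorizations:
  assumes "drazin_equations a l x"
  shows "a * x = a ^ l * x ^ l" "a * x = x ^ l * a ^ l"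
    "x = a ^ l * (x ^ l * x)" "x = x * x ^ l * a ^ l"
proof -
  note D = drazin_equationsD[OF assms]
  show right: "a * x = a ^ l * x ^ l"
    using outer_inverse_power_mult D by metis
  have "a ^ l * x ^ l = x ^ l * a ^ l"
    using D(2) by (metis power_commuting_commutes)
  with right show left: "a * x = x ^ l * a ^ l" by simp
  show "x = a ^ l * (x ^ l * x)"
    using D(2,3) right by (metis mult.assoc)
  show "x = x * x ^ l * a ^ l"
    using D(3) left by (metis mult.assoc)
qed

lemma drazin_equations_mono:
  assumes "drazin_equations a k x" "k \<le> l"
  shows "drazin_equations a l x"
proof (rule drazin_equationsI)
  note D = drazin_equationsD[OF assms(1)]
  show "l \<ge> 1" "a * x = x * a" "x * a * x = x" using D assms(2) by auto
  have "a ^ l = a ^ k * a ^ (l - k)" using assms(2) by (simp flip: power_add)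
  then show "a * x * a ^ l = a ^ l" using D(5) by (metis mult.assoc)
qed

section \<open>The Drazin equations as projections\<close>

lemma drazin_imp_left_mult_projection:
  assumes "drazin_equations a l x"
  shows "is_proj_onto (left_mult (a * x)) (right_ideal_of (a ^ l)) (rann (a ^ l))"
  unfolding right_ideal_of_eq_range rann_eq_kernel
proof (rule is_proj_onto_range_kernelI[OF additive_left_mult])
  note D = drazin_equationsD[OF assms] and F = drazin_idempotent_factorizations[OF assms]
  fix r
  show "left_mult (a * x) r \<in> range (left_mult (a ^ l))"
    unfolding left_mult_def using F(1) by (metis mult.assoc rangeI)
  show "left_mult (a * x) (left_mult (a ^ l) r) = left_mult (a ^ l) r"
    unfolding left_mult_def using D(5) by (metis mult.assoc)
  show "left_mult (a ^ l) (left_mult (a * x) r) = left_mult (a ^ l) r"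
    unfolding left_mult_def using D(4) by (metis mult.assoc)
  show "left_mult (a * x) r = 0" if "left_mult (a ^ l) r = 0"
    using that unfolding left_mult_def F(2) by (simp add: mult.assoc)
qed

lemma drazin_imp_right_mult_projection:
  assumes "drazin_equations a l x"
  shows "is_proj_onto (right_mult (a * x)) (left_ideal_of (a ^ l)) (lann (a ^ l))"
  unfolding left_ideal_of_eq_range lann_eq_kernel
proof (rule is_proj_onto_range_kernelI[OF additive_right_mult])
  note D = drazin_equationsD[OF assms] and F = drazin_idempotent_factorizations[OF assms]
  fix r
  show "right_mult (a * x) r \<in> range (right_mult (a ^ l))"
    unfolding right_mult_def using F(2) by (metis mult.assoc rangeI)
  show "right_mult (a * x) (right_mult (a ^ l) r) = right_mult (a ^ l) r"
    unfolding right_mult_def using D(4) by (metis mult.assoc)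
  show "right_mult (a ^ l) (right_mult (a * x) r) = right_mult (a ^ l) r"
    unfolding right_mult_def using D(5) by (metis mult.assoc)
  show "right_mult (a * x) r = 0" if "right_mult (a ^ l) r = 0"
    using that unfolding right_mult_def F(1) by (simp flip: mult.assoc)
qed

lemma left_mult_projection_imp_drazin:
  assumes "l \<ge> 1" and comm: "a * x = x * a"
    and proj: "is_proj_onto (left_mult (a * x)) (right_ideal_of (a ^ l)) (rann (a ^ l))"
    and incl: "right_ideal_of x \<subseteq> right_ideal_of (a ^ l) \<or> rann (a ^ l) \<subseteq> rann x"
  shows "drazin_equations a l x"
proof (rule drazin_equationsI[OF assms(1,2)])
  show "a * x * a ^ l = a ^ l"
    using is_proj_onto_fixes[OF proj self_in_right_ideal_of] by (simp add: left_mult_def)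
  show "x * a * x = x"
    using incl
  proof
    assume "right_ideal_of x \<subseteq> right_ideal_of (a ^ l)"
    then have "x \<in> right_ideal_of (a ^ l)" using self_in_right_ideal_of by blast
    then show ?thesis
      using is_proj_onto_fixes[OF proj] comm by (simp add: left_mult_def)
  next
    assume "rann (a ^ l) \<subseteq> rann x"
    moreover have "1 - left_mult (a * x) 1 \<in> rann (a ^ l)"
      using proj unfolding is_proj_onto_iff by blast
    ultimately have "x * (1 - a * x) = 0" by (auto simp: rann_def left_mult_def)
    then show ?thesis by (simp add: algebra_simps)
  qed
qed

lemma right_mult_projection_imp_drazin:
  assumes "l \<ge> 1" and comm: "a * x = x * a"
    and proj: "is_proj_onto (right_mult (a * x)) (left_ideal_of (a ^ l)) (lann (a ^ l))"
    and incl: "left_ideal_of x \<subseteq> left_ideal_of (a ^ l) \<or> lann (a ^ l) \<subseteq> lann x"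
  shows "drazin_equations a l x"
proof (rule drazin_equationsI[OF assms(1,2)])
  \<comment> \<open>Fixing the image would give \<open>a ^ l * (a * x) = a ^ l\<close>, with the factors in the other order.\<close>
  have "1 - right_mult (a * x) 1 \<in> lann (a ^ l)"
    using proj unfolding is_proj_onto_iff by blast
  then have kernel: "1 - a * x \<in> lann (a ^ l)" by (simp add: right_mult_def)
  then show "a * x * a ^ l = a ^ l" by (simp add: lann_def algebra_simps)
  show "x * a * x = x"
    using incl
  proof
    assume "left_ideal_of x \<subseteq> left_ideal_of (a ^ l)"
    then have "x \<in> left_ideal_of (a ^ l)" using self_in_left_ideal_of by blast
    then show ?thesis
      using is_proj_onto_fixes[OF proj] by (simp add: right_mult_def mult.assoc)
  next
    assume "lann (a ^ l) \<subseteq> lann x"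
    with kernel have "(1 - a * x) * x = 0" by (auto simp: lann_def)
    then show ?thesis using comm by (simp add: algebra_simps)
  qed
qed

lemma drazin_imp_inclusions:
  assumes "drazin_equations a l x"
  shows "right_ideal_of x \<subseteq> right_ideal_of (a ^ l)" "rann (a ^ l) \<subseteq> rann x"
    "left_ideal_of x \<subseteq> left_ideal_of (a ^ l)" "lann (a ^ l) \<subseteq> lann x"
proof -
  note F = drazin_idempotent_factorizations[OF assms]
  show "right_ideal_of x \<subseteq> right_ideal_of (a ^ l)"
    unfolding right_ideal_of_subset_iff using F(3) by blast
  show "left_ideal_of x \<subseteq> left_ideal_of (a ^ l)"
    unfolding left_ideal_of_subset_iff using F(4) by blast
  show "rann (a ^ l) \<subseteq> rann x"
    unfolding rann_def using F(4) by (metis (mono_tags, lifting) Collect_mono mult.assoc mult_zero_right)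
  show "lann (a ^ l) \<subseteq> lann x"
    unfolding lann_def using F(3) by (metis (mono_tags, lifting) Collect_mono mult.assoc mult_zero_left)
qed

section \<open>Index and Drazin inverse\<close>

text \<open>
  Both \<open>a * x\<close> and \<open>a * y\<close> induce the projection onto the right ideal of a common power of \<open>a\<close> along
  its right annihilator, so they agree, and then \<open>x = x * (a * y) = (x * a) * y = y\<close>.
\<close>

lemma drazin_equations_unique:
  assumes "drazin_equations a k x" "drazin_equations a m y"
  shows "x = y"
proof -
  have x: "drazin_equations a (max k m) x" and y: "drazin_equations a (max k m) y"
    using assms by (auto intro: drazin_equations_mono)
  have "left_mult (a * x) = left_mult (a * y)"
    using x y by (meson drazin_imp_left_mult_projection is_proj_onto_unique)
  then have e: "a * x = a * y" by (simp add: left_mult_eq_iff)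
  have "x = x * (a * y)" using drazin_equationsD(3)[OF x] e by (simp add: mult.assoc)
  also have "\<dots> = a * y * y" using drazin_equationsD(2)[OF x] e by (metis mult.assoc)
  also have "\<dots> = y" using drazin_equationsD(2,3)[OF y] by simp
  finally show ?thesis .
qed

lemma drazin_inverse_index_le_iff:
  "drazin_invertible a \<and> drazin_index a \<le> l \<and> x = drazin_inverse a \<longleftrightarrow> drazin_equations a l x"
proof
  assume D: "drazin_equations a l x"
  have "drazin_invertible a" using D by (auto simp: drazin_invertible_def)
  moreover have "drazin_index a \<le> l"
    unfolding drazin_index_def using D by (blast intro: Least_le)
  moreover have "drazin_inverse a = x"
    unfolding drazin_inverse_def using D by (blast intro: drazin_equations_unique)
  ultimately show "drazin_invertible a \<and> drazin_index a \<le> l \<and> x = drazin_inverse a" by simp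
next
  assume A: "drazin_invertible a \<and> drazin_index a \<le> l \<and> x = drazin_inverse a"
  then have "\<exists>k y. drazin_equations a k y" by (simp add: drazin_invertible_def)
  then have "\<exists>y. drazin_equations a (drazin_index a) y"
    unfolding drazin_index_def by (rule LeastI_ex)
  then obtain y where y: "drazin_equations a (drazin_index a) y" ..
  then have "drazin_inverse a = y"
    unfolding drazin_inverse_def by (blast intro: drazin_equations_unique)
  with y A show "drazin_equations a l x" by (auto intro: drazin_equations_mono)
qed

section \<open>The equivalence\<close>

theorem theorem3p8:
  fixes a x :: "'a::ring_1" and l :: nat
  assumes "l \<ge> 1"
  shows "let
      A1 = (drazin_invertible a \<and> drazin_index a \<le> l \<and> x = drazin_inverse a);
      A2 = (left_mult (x * a) = left_mult (a * x) \<and>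
            is_proj_onto (left_mult (a * x)) (right_ideal_of (a ^ l)) (rann (a ^ l)) \<and>
            right_ideal_of x \<subseteq> right_ideal_of (a ^ l));
      A3 = (left_mult (x * a) = left_mult (a * x) \<and>
            is_proj_onto (left_mult (a * x)) (right_ideal_of (a ^ l)) (rann (a ^ l)) \<and>
            rann (a ^ l) \<subseteq> rann x);
      A4 = (right_mult (x * a) = right_mult (a * x) \<and>
            is_proj_onto (right_mult (a * x)) (left_ideal_of (a ^ l)) (lann (a ^ l)) \<and>
            left_ideal_of x \<subseteq> left_ideal_of (a ^ l));
      A5 = (right_mult (x * a) = right_mult (a * x) \<and>
            is_proj_onto (right_mult (a * x)) (left_ideal_of (a ^ l)) (lann (a ^ l)) \<and>
            lann (a ^ l) \<subseteq> lann x)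
    in (A1 \<longleftrightarrow> A2) \<and> (A2 \<longleftrightarrow> A3) \<and> (A3 \<longleftrightarrow> A4) \<and> (A4 \<longleftrightarrow> A5)"
proof -
  let ?D = "drazin_equations a l x"
  have left: "left_mult (x * a) = left_mult (a * x) \<longleftrightarrow> a * x = x * a"
    and right: "right_mult (x * a) = right_mult (a * x) \<longleftrightarrow> a * x = x * a"
    by (auto simp: left_mult_eq_iff right_mult_eq_iff)
  note to_D = left_mult_projection_imp_drazin[OF assms] right_mult_projection_imp_drazin[OF assms]
  note from_D = drazin_equationsD(2) drazin_imp_left_mult_projection
    drazin_imp_right_mult_projection drazin_imp_inclusions
  have "left_mult (x * a) = left_mult (a * x) \<and>
      is_proj_onto (left_mult (a * x)) (right_ideal_of (a ^ l)) (rann (a ^ l)) \<and>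
      right_ideal_of x \<subseteq> right_ideal_of (a ^ l) \<longleftrightarrow> ?D"
    unfolding left by (meson to_D from_D)
  moreover have "left_mult (x * a) = left_mult (a * x) \<and>
      is_proj_onto (left_mult (a * x)) (right_ideal_of (a ^ l)) (rann (a ^ l)) \<and>
      rann (a ^ l) \<subseteq> rann x \<longleftrightarrow> ?D"
    unfolding left by (meson to_D from_D)
  moreover have "right_mult (x * a) = right_mult (a * x) \<and>
      is_proj_onto (right_mult (a * x)) (left_ideal_of (a ^ l)) (lann (a ^ l)) \<and>
      left_ideal_of x \<subseteq> left_ideal_of (a ^ l) \<longleftrightarrow> ?D"
    unfolding right by (meson to_D from_D)
  moreover have "right_mult (x * a) = right_mult (a * x) \<and>
      is_proj_onto (right_mult (a * x)) (left_ideal_of (a ^ l)) (lann (a ^ l)) \<and>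
      lann (a ^ l) \<subseteq> lann x \<longleftrightarrow> ?D"
    unfolding right by (meson to_D from_D)
  ultimately show ?thesis
    unfolding Let_def drazin_inverse_index_le_iff by metis
qed

end
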